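(* Consider the atom+field system with Weinberg's (Fock-basis) composite Hamiltonian function described in the context. Let $t\mapsto\psi(t)$ be a solution of the corresponding nonlinear Schrödinger equation such that the only nonvanishing component of $\psi(0)$ is $\psi_{11}(0)$ (atom in level $1$, one photon). Then only the components $\psi_{11}$ and $\psi_{20}$ are ever nonvanishing, and they satisfy the linear system $$i\hbar\dot\psi_{11}=(\hbar\omega_1+\hbar\omega+\epsilon_1^2)\psi_{11}-\tfrac i2\hbar q\,\psi_{20},\qquad i\hbar\dot\psi_{20}=(\hbar\omega_2+\epsilon_2^2)\psi_{20}+\tfrac i2\hbar q\,\psi_{11}.$$
   Context: Setting. The atom has levels $k=1,2,\dots,K$ ($K\ge 2$) with real frequencies $\omega_k$ and real nonlinearity parameters $\epsilon_k$. The field is a single mode of frequency $\omega$ with annihilation and creation operators $a,a^\dagger$, where $a|n\rangle=\sqrt n\,|n-1\rangle$. The constants $\hbar>0$ and $q\in\mathbb R$ are given. A state of the composite system is $|\psi\rangle=\sum_{k,n}\psi_{kn}|k\rangle|n\rangle$, with $k$ the atomic level and $n=0,1,2,\dots$ the photon number. The operators $b_k,b_k^\dagger$ are the atomic annihilation and creation operators; on these (one-excitation) states $b_k^\dagger b_l$ acts as $|k\rangle\langle l|\otimes\mathbf 1$. $\hat P_n$ denotes the projection onto $n$-photon states. The Hamiltonian function is $$H(\psi,\bar\psi)=\langle\psi|\sum_k\hbar\omega_k b_k^\dagger b_k+\hbar\omega a^\dagger a+\tfrac{i\hbar q}{2}(b_2^\dagger b_1a-a^\dagger b_1^\dagger b_2)|\psi\rangle+\sum_n\frac{\langle\psi|\sum_k\epsilon_kb_k^\dagger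 b_k\hat P_n|\psi\rangle^2}{\langle\psi|\hat P_n|\psi\rangle},$$ where a summand of the last sum is taken to be $0$ when $\hat P_n\psi=0$ (it then extends continuously, with continuous first derivatives equal to $0$). The nonlinear Schrödinger equation is $i\hbar\,\dot\psi_{kn}=\partial H/\partial\bar\psi_{kn}$. Explicitly, with $E_n=\sum_l\epsilon_l|\psi_{ln}|^2\big/\sum_l|\psi_{ln}|^2$ (the terms $(2E_n\epsilon_k-E_n^2)\psi_{kn}$ being read as $0$ when $\psi_{ln}=0$ for all $l$), $$i\hbar\dot\psi_{1n}=\{\hbar\omega_1+2E_n\epsilon_1-E_n^2+n\hbar\omega\}\psi_{1n}-\tfrac i2\hbar q\sqrt n\,\psi_{2,n-1},$$ $$i\hbar\dot\psi_{2n}=\{\hbar\omega_2+2E_n\epsilon_2-E_n^2+n\hbar\omega\}\psi_{2n}+\tfrac i2\hbar q\sqrt{n+1}\,\psi_{1,n+1},$$ $$i\hbar\dot\psi_{kn}=\{\hbar\omega_k+2E_n\epsilon_k-E_n^2+n\hbar\omega\}\psi_{kn}\quad(k>2).$$ *)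

theory Defs
  imports "HOL-Analysis.Analysis"
begin

text \<open>A vector \<open>\<Sum>k n. \<psi> k n |k\<rangle>|n\<rangle>\<close> is given by its components \<open>\<psi> k n\<close>. The atomic levels
  are \<open>k \<in> {1..K}\<close>; components with \<open>k\<close> outside this range are never looked at.\<close>

type_synonym state = "nat \<Rightarrow> nat \<Rightarrow> complex"

text \<open>Linear operators act on components, so \<open>a|n\<rangle> = \<surd>n |n-1\<rangle>\<close> becomes
  \<open>(a \<psi>)\<^sub>k\<^sub>n = \<surd>(n+1) \<psi>\<^sub>k\<^sub>,\<^sub>n\<^sub>+\<^sub>1\<close>.\<close>

definition annih :: "state \<Rightarrow> state" where
  "annih \<psi> = (\<lambda>k n. complex_of_real (sqrt (real (n + 1))) * \<psi> k (n + 1))"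

text \<open>For \<open>n = 0\<close> the factor \<open>sqrt 0\<close> removes the truncated index \<open>n - 1\<close>.\<close>

definition creat :: "state \<Rightarrow> state" where
  "creat \<psi> = (\<lambda>k n. complex_of_real (sqrt (real n)) * \<psi> k (n - 1))"

text \<open>\<open>b\<^sub>i\<^sup>\<dagger> b\<^sub>j = |i\<rangle>\<langle>j| \<otimes> 1\<close>.\<close>

definition transition :: "nat \<Rightarrow> nat \<Rightarrow> state \<Rightarrow> state" where
  "transition i j \<psi> = (\<lambda>k n. if k = i then \<psi> j n else 0)"

definition photon_proj :: "nat \<Rightarrow> state \<Rightarrow> state" where
  "photon_proj m \<psi> = (\<lambda>k n. if n = m then \<psi> k n else 0)"

definition braket :: "nat \<Rightarrow> state \<Rightarrow> state \<Rightarrow> complex" where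
  "braket K \<phi> \<eta> = (\<Sum>\<^sub>\<infinity>(k, n)\<in>{1..K} \<times> UNIV. cnj (\<phi> k n) * \<eta> k n)"

definition linear_hamiltonian ::
  "nat \<Rightarrow> real \<Rightarrow> real \<Rightarrow> real \<Rightarrow> (nat \<Rightarrow> real) \<Rightarrow> state \<Rightarrow> state" where
  "linear_hamiltonian K hbar q \<omega> \<omega>s \<psi> = (\<lambda>k n.
     (\<Sum>j\<in>{1..K}. complex_of_real (hbar * \<omega>s j) * transition j j \<psi> k n)
     + complex_of_real (hbar * \<omega>) * creat (annih \<psi>) k n
     + \<i> * complex_of_real (hbar * q) / 2 *
         (transition 2 1 (annih \<psi>) k n - creat (transition 1 2 \<psi>) k n))"

definition nonlinearity :: "nat \<Rightarrow> (nat \<Rightarrow> real) \<Rightarrow> state \<Rightarrow> state" where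
  "nonlinearity K \<epsilon> \<psi> = (\<lambda>k n. \<Sum>j\<in>{1..K}. complex_of_real (\<epsilon> j) * transition j j \<psi> k n)"

text \<open>If the \<open>n\<close>-photon part of \<open>\<psi>\<close> is zero, the value is \<open>0 / 0 = 0\<close>, as required.\<close>

definition weinberg_term :: "nat \<Rightarrow> (nat \<Rightarrow> real) \<Rightarrow> nat \<Rightarrow> state \<Rightarrow> complex" where
  "weinberg_term K \<epsilon> n \<psi> =
     (braket K \<psi> (nonlinearity K \<epsilon> (photon_proj n \<psi>)))\<^sup>2 / braket K \<psi> (photon_proj n \<psi>)"

definition hamiltonian ::
  "nat \<Rightarrow> real \<Rightarrow> real \<Rightarrow> real \<Rightarrow> (nat \<Rightarrow> real) \<Rightarrow> (nat \<Rightarrow> real) \<Rightarrow> state \<Rightarrow> complex" where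
  "hamiltonian K hbar q \<omega> \<omega>s \<epsilon> \<psi> =
     braket K \<psi> (linear_hamiltonian K hbar q \<omega> \<omega>s \<psi>) + (\<Sum>\<^sub>\<infinity>n. weinberg_term K \<epsilon> n \<psi>)"

text \<open>Divergent sums have the default value 0, so \<open>hamiltonian\<close> is meaningful only on the vectors
  for which both of its series converge.\<close>

definition hamiltonian_dom ::
  "nat \<Rightarrow> real \<Rightarrow> real \<Rightarrow> real \<Rightarrow> (nat \<Rightarrow> real) \<Rightarrow> (nat \<Rightarrow> real) \<Rightarrow> state set" where
  "hamiltonian_dom K hbar q \<omega> \<omega>s \<epsilon> =
     {\<psi>. (\<lambda>(k, n). cnj (\<psi> k n) * linear_hamiltonian K hbar q \<omega> \<omega>s \<psi> k n)
            summable_on {1..K} \<times> UNIV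
        \<and> (\<lambda>n. weinberg_term K \<epsilon> n \<psi>) summable_on UNIV}"

definition shift_component :: "state \<Rightarrow> nat \<Rightarrow> nat \<Rightarrow> complex \<Rightarrow> state" where
  "shift_component \<psi> k n z = (\<lambda>k' n'. if k' = k \<and> n' = n then \<psi> k n + z else \<psi> k' n')"

text \<open>\<open>D = \<partial>F/\<partial>\<psi>\<^sub>k\<^sub>n\<^sup>*\<close> at \<open>\<psi>\<close>, in the Wirtinger sense \<open>\<partial>/\<partial>z\<^sup>* = (\<partial>/\<partial>x + \<i> \<partial>/\<partial>y) / 2\<close> for
  \<open>z = x + \<i> y\<close>; \<open>L\<close> is the real-linear derivative.\<close>

definition has_cnj_partial :: "(state \<Rightarrow> complex) \<Rightarrow> complex \<Rightarrow> state \<Rightarrow> nat \<Rightarrow> nat \<Rightarrow> bool" where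
  "has_cnj_partial F D \<psi> k n \<longleftrightarrow>
     (\<exists>L. ((\<lambda>z. F (shift_component \<psi> k n z)) has_derivative L) (at 0) \<and> D = (L 1 + \<i> * L \<i>) / 2)"

text \<open>The Schroedinger equation \<open>\<i> hbar d\<psi>\<^sub>k\<^sub>n/dt = \<partial>H/\<partial>\<psi>\<^sub>k\<^sub>n\<^sup>*\<close>, componentwise on a time set \<open>T\<close>.\<close>

definition schroedinger_solution ::
  "nat \<Rightarrow> real \<Rightarrow> real \<Rightarrow> real \<Rightarrow> (nat \<Rightarrow> real) \<Rightarrow> (nat \<Rightarrow> real) \<Rightarrow> real set \<Rightarrow> (real \<Rightarrow> state) \<Rightarrow> bool"
  where
  "schroedinger_solution K hbar q \<omega> \<omega>s \<epsilon> T \<psi> \<longleftrightarrow>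
     (\<forall>t\<in>T. \<psi> t \<in> hamiltonian_dom K hbar q \<omega> \<omega>s \<epsilon> \<and>
        (\<forall>k\<in>{1..K}. \<forall>n. \<exists>d. ((\<lambda>s. \<psi> s k n) has_vector_derivative d) (at t within T) \<and>
           has_cnj_partial (hamiltonian K hbar q \<omega> \<omega>s \<epsilon>) (\<i> * complex_of_real hbar * d) (\<psi> t) k n))"

end

theory Submission
  imports Defs
begin

text \<open>The interaction couples each component \<open>\<psi>\<^sub>1\<^sub>,\<^sub>n\<^sub>+\<^sub>1\<close> only with \<open>\<psi>\<^sub>2\<^sub>,\<^sub>n\<close>, by Hermitian conjugate
  coefficients, and Weinberg's nonlinear term multiplies each component by a real factor. Hence
  every \<open>\<bar>\<psi>\<^sub>1\<^sub>,\<^sub>n\<^sub>+\<^sub>1\<bar>\<^sup>2 + \<bar>\<psi>\<^sub>2\<^sub>,\<^sub>n\<bar>\<^sup>2\<close> and the modulus of every uncoupled component is conserved, so that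
  components outside the initially excited pair stay zero. In the 1-photon and in the 0-photon
  sector there is then just one nonzero component, so \<open>E\<^sub>n = \<epsilon>\<^sub>k\<close> for it and the nonlinear factor
  \<open>2 E\<^sub>n \<epsilon>\<^sub>k - E\<^sub>n\<^sup>2\<close> is \<open>\<epsilon>\<^sub>k\<^sup>2\<close>.\<close>

text \<open>Uncoupled components are their own partners; they have coupling 0.\<close>

definition partner :: "nat \<times> nat \<Rightarrow> nat \<times> nat" where
  "partner = (\<lambda>(k, n). if k = 2 then (1, n + 1) else if k = 1 \<and> n > 0 then (2, n - 1) else (k, n))"

definition coupling :: "real \<Rightarrow> real \<Rightarrow> nat \<times> nat \<Rightarrow> complex" where
  "coupling hbar q = (\<lambda>(k, n).
     if k = 2 then \<i> * complex_of_real (hbar * q) / 2 * complex_of_real (sqrt (real (n + 1)))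
     else if k = 1 then - (\<i> * complex_of_real (hbar * q) / 2 * complex_of_real (sqrt (real n)))
     else 0)"

definition photon_weight :: "nat \<Rightarrow> state \<Rightarrow> nat \<Rightarrow> real" where
  "photon_weight K \<psi> n = (\<Sum>j\<in>{1..K}. (cmod (\<psi> j n))\<^sup>2)"

definition weighted_eps :: "nat \<Rightarrow> (nat \<Rightarrow> real) \<Rightarrow> state \<Rightarrow> nat \<Rightarrow> real" where
  "weighted_eps K \<epsilon> \<psi> n = (\<Sum>j\<in>{1..K}. \<epsilon> j * (cmod (\<psi> j n))\<^sup>2)"

text \<open>Division by zero makes this 0 on an empty photon sector, in accordance with the convention
  for the nonlinear terms of the equation.\<close>

definition mean_eps :: "nat \<Rightarrow> (nat \<Rightarrow> real) \<Rightarrow> state \<Rightarrow> nat \<Rightarrow> real" where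
  "mean_eps K \<epsilon> \<psi> n = weighted_eps K \<epsilon> \<psi> n / photon_weight K \<psi> n"

definition nonlinear_factor :: "nat \<Rightarrow> (nat \<Rightarrow> real) \<Rightarrow> state \<Rightarrow> nat \<Rightarrow> nat \<Rightarrow> real" where
  "nonlinear_factor K \<epsilon> \<psi> k n = 2 * mean_eps K \<epsilon> \<psi> n * \<epsilon> k - (mean_eps K \<epsilon> \<psi> n)\<^sup>2"

section \<open>The pairing of components and the linear part of the Hamiltonian\<close>

lemma partner_partner [simp]: "k \<noteq> 0 \<Longrightarrow> partner (partner (k, n)) = (k, n)"
  by (auto simp: partner_def)

lemma partner_in_levels: "K \<ge> 2 \<Longrightarrow> p \<in> {1..K} \<times> UNIV \<Longrightarrow> partner p \<in> {1..K} \<times> UNIV"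
  by (auto simp: partner_def split: if_splits)

text \<open>The fixed points of \<open>partner\<close> are the components of levels other than 1 and
  2, and \<open>(1, 0)\<close>, where the factor \<open>sqrt 0\<close> vanishes.\<close>

lemma coupling_eq_0: "partner p = p \<Longrightarrow> coupling hbar q p = 0"
  by (auto simp: partner_def coupling_def split: if_splits prod.splits)

text \<open>Between \<open>(2, n)\<close> and \<open>(1, n + 1)\<close> the root of
  \<open>n + 1\<close> is the same and an imaginary number changes sign, which is conjugation. This
  is the Hermiticity of the interaction.\<close>

lemma coupling_partner:
  "partner p \<noteq> p \<Longrightarrow> coupling hbar q (partner p) = cnj (coupling hbar q p)"
  by (auto simp: partner_def coupling_def split: if_splits prod.splits)

text \<open>The number operator is diagonal. At \<open>n = 0\<close> the truncated index is
  harmless, since both sides carry a factor 0.\<close>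

lemma creat_annih: "creat (annih \<psi>) k n = of_nat n * \<psi> k n"
proof (cases n)
  case (Suc m)
  have "complex_of_real (sqrt (real n)) * complex_of_real (sqrt (real n)) = of_nat n"
    by (simp flip: of_real_mult)
  then show ?thesis
    by (simp add: creat_def annih_def Suc mult.assoc[symmetric])
qed (simp add: creat_def)

text \<open>Besides the diagonal entry, each row of the operator has at most one nonzero entry, in
  the column given by \<open>partner\<close>.\<close>

lemma linear_hamiltonian_eq:
  assumes "k \<in> {1..K}"
  shows "linear_hamiltonian K hbar q \<omega> \<omega>s \<psi> k n =
    complex_of_real (hbar * \<omega>s k + hbar * \<omega> * real n) * \<psi> k n
    + coupling hbar q (k, n) * case_prod \<psi> (partner (k, n))"
proof -
  have "(\<Sum>j\<in>{1..K}. complex_of_real (hbar * \<omega>s j) * transition j j \<psi> k n)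
      = (\<Sum>j\<in>{1..K}. if k = j then complex_of_real (hbar * \<omega>s j) * \<psi> j n else 0)"
    by (intro sum.cong) (auto simp: transition_def)
  also have "\<dots> = complex_of_real (hbar * \<omega>s k) * \<psi> k n"
    using assms by simp
  finally have diag: "(\<Sum>j\<in>{1..K}. complex_of_real (hbar * \<omega>s j) * transition j j \<psi> k n)
      = complex_of_real (hbar * \<omega>s k) * \<psi> k n" .
  have off: "\<i> * complex_of_real (hbar * q) / 2 *
        (transition 2 1 (annih \<psi>) k n - creat (transition 1 2 \<psi>) k n)
      = coupling hbar q (k, n) * case_prod \<psi> (partner (k, n))"
    by (auto simp: transition_def creat_def annih_def coupling_def partner_def)
  show ?thesis
    unfolding linear_hamiltonian_def diag off creat_annih by (simp add: algebra_simps)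
qed

section \<open>Weinberg's term and its derivative in one component\<close>

text \<open>Every term outside the \<open>n\<close>-photon sector vanishes, so the series is a
  finite sum whatever \<open>\<phi>\<close> is.\<close>

lemma braket_one_sector:
  assumes "\<And>k m. k \<in> {1..K} \<Longrightarrow> m \<noteq> n \<Longrightarrow> \<eta> k m = 0"
  shows "braket K \<phi> \<eta> = (\<Sum>k\<in>{1..K}. cnj (\<phi> k n) * \<eta> k n)"
proof -
  have zero: "(case x of (k, m) \<Rightarrow> cnj (\<phi> k m) * \<eta> k m) = 0"
    if "x \<in> {1..K} \<times> UNIV - {1..K} \<times> {n}" for x
    using that by (cases x) (simp add: assms del: atLeastAtMost_iff One_nat_def)
  have "braket K \<phi> \<eta> = (\<Sum>\<^sub>\<infinity>(k, m)\<in>{1..K} \<times> {n}. cnj (\<phi> k m) * \<eta> k m)"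
    unfolding braket_def by (rule infsum_cong_neutral[OF _ zero refl]) auto
  also have "\<dots> = (\<Sum>(k, m)\<in>{1..K} \<times> {n}. cnj (\<phi> k m) * \<eta> k m)"
    by simp
  also have "\<dots> = (\<Sum>k\<in>{1..K}. \<Sum>m\<in>{n}. cnj (\<phi> k m) * \<eta> k m)"
    by (rule sum.cartesian_product[symmetric])
  finally show ?thesis by simp
qed

lemma weinberg_term_eq:
  "weinberg_term K \<epsilon> n \<psi> =
    complex_of_real ((weighted_eps K \<epsilon> \<psi> n)\<^sup>2 / photon_weight K \<psi> n)"
proof -
  have nl: "nonlinearity K \<epsilon> (photon_proj n \<psi>) k m =
      (if m = n then complex_of_real (\<epsilon> k) * \<psi> k m else 0)" if "k \<in> {1..K}" for k m
  proof -
    have "nonlinearity K \<epsilon> (photon_proj n \<psi>) k m =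
        (\<Sum>j\<in>{1..K}. if k = j then (if m = n then complex_of_real (\<epsilon> j) * \<psi> j m else 0) else 0)"
      unfolding nonlinearity_def by (intro sum.cong) (auto simp: transition_def photon_proj_def)
    then show ?thesis using that by simp
  qed
  have "braket K \<psi> (nonlinearity K \<epsilon> (photon_proj n \<psi>)) =
      (\<Sum>k\<in>{1..K}. cnj (\<psi> k n) * nonlinearity K \<epsilon> (photon_proj n \<psi>) k n)"
    by (rule braket_one_sector) (simp add: nl)
  also have "\<dots> = (\<Sum>k\<in>{1..K}. complex_of_real (\<epsilon> k * (cmod (\<psi> k n))\<^sup>2))"
    by (intro sum.cong) (auto simp: nl complex_norm_square simp del: of_real_power)
  finally have num: "braket K \<psi> (nonlinearity K \<epsilon> (photon_proj n \<psi>)) =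
      complex_of_real (weighted_eps K \<epsilon> \<psi> n)"
    by (simp add: weighted_eps_def)
  have "braket K \<psi> (photon_proj n \<psi>) = (\<Sum>k\<in>{1..K}. cnj (\<psi> k n) * photon_proj n \<psi> k n)"
    by (rule braket_one_sector) (simp add: photon_proj_def)
  also have "\<dots> = (\<Sum>k\<in>{1..K}. complex_of_real ((cmod (\<psi> k n))\<^sup>2))"
    by (intro sum.cong) (auto simp: photon_proj_def complex_norm_square simp del: of_real_power)
  finally have den: "braket K \<psi> (photon_proj n \<psi>) = complex_of_real (photon_weight K \<psi> n)"
    by (simp add: photon_weight_def)
  show ?thesis unfolding weinberg_term_def num den by simp
qed

lemma sum_shift_component:
  fixes w :: "nat \<Rightarrow> real"
  assumes "k \<in> {1..K}"
  shows "(\<Sum>j\<in>{1..K}. w j * (cmod (shift_component \<psi> k n z j n))\<^sup>2) =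
    (\<Sum>j\<in>{1..K} - {k}. w j * (cmod (\<psi> j n))\<^sup>2) + w k * (cmod (\<psi> k n + z))\<^sup>2"
proof -
  have "(\<Sum>j\<in>{1..K} - {k}. w j * (cmod (shift_component \<psi> k n z j n))\<^sup>2) =
      (\<Sum>j\<in>{1..K} - {k}. w j * (cmod (\<psi> j n))\<^sup>2)"
    by (intro sum.cong) (auto simp: shift_component_def)
  then show ?thesis
    unfolding sum.remove[OF finite_atLeastAtMost assms] by (simp add: shift_component_def)
qed

lemma shift_component_0 [simp]: "shift_component \<psi> k n 0 = \<psi>"
  by (auto simp: shift_component_def fun_eq_iff)

text \<open>As a function of one component, Weinberg's term has this form, with \<open>a\<close> and
  \<open>b\<close> collected from the other levels. The numerator base varies \<open>e\<close> times
  as fast as the denominator, so the quotient rule gives the factor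
  \<open>2 * E * e - E\<^sup>2\<close>.\<close>

lemma has_derivative_square_quotient:
  fixes u :: complex and a b e :: real
  assumes "b \<ge> 0" and "b = 0 \<Longrightarrow> a = 0"
  defines "E \<equiv> (a + e * (cmod u)\<^sup>2) / (b + (cmod u)\<^sup>2)"
  shows "((\<lambda>z. (a + e * (cmod (u + z))\<^sup>2)\<^sup>2 / (b + (cmod (u + z))\<^sup>2)) has_derivative
    (\<lambda>h. (2 * E * e - E\<^sup>2) * (2 * (u \<bullet> h)))) (at 0)"
proof (cases "b + (cmod u)\<^sup>2 = 0")
  case True
  then have [simp]: "b = 0" "u = 0" "a = 0"
    using assms(1,2) by (simp_all add: add_nonneg_eq_0_iff)
  \<comment> \<open>At the singular point the quotient collapses to a multiple of the squared
    modulus, also at \<open>z = 0\<close> because \<open>0 / 0 = 0\<close>. Its derivative there is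
    0.\<close>
  have "(\<lambda>z. (a + e * (cmod (u + z))\<^sup>2)\<^sup>2 / (b + (cmod (u + z))\<^sup>2)) = (\<lambda>z. e\<^sup>2 * (z \<bullet> z))"
    by (auto simp: fun_eq_iff power2_norm_eq_inner[symmetric] power2_eq_square)
  moreover have "((\<lambda>z::complex. e\<^sup>2 * (z \<bullet> z)) has_derivative (\<lambda>h. 0)) (at 0)"
    by (auto intro!: derivative_eq_intros)
  ultimately show ?thesis by simp
next
  case False
  then have nz: "b + u \<bullet> u \<noteq> 0" by (simp add: power2_norm_eq_inner)
  have E: "E = (a + e * (u \<bullet> u)) / (b + u \<bullet> u)"
    by (simp add: E_def power2_norm_eq_inner)
  \<comment> \<open>Over the squared denominator the factor has the shape that the quotient rule
    delivers.\<close>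
  have quot: "2 * E * e - E\<^sup>2 =
      (2 * (a + e * (u \<bullet> u)) * e * (b + u \<bullet> u) - (a + e * (u \<bullet> u))\<^sup>2)
        / ((b + u \<bullet> u) * (b + u \<bullet> u))"
  proof -
    have "2 * (P / B) * e - (P / B)\<^sup>2 = (2 * P * e * B - P\<^sup>2) / (B * B)" if "B \<noteq> 0" for P B
      using that by (simp add: field_simps power2_eq_square)
    from this[OF nz] show ?thesis unfolding E .
  qed
  have num: "((\<lambda>z. a + e * ((u + z) \<bullet> (u + z))) has_derivative (\<lambda>h. 2 * e * (u \<bullet> h))) (at 0)"
    and den: "((\<lambda>z. b + (u + z) \<bullet> (u + z)) has_derivative (\<lambda>h. 2 * (u \<bullet> h))) (at 0)"
    by (rule derivative_eq_intros refl ext | simp add: inner_commute algebra_simps)+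
  show ?thesis
    unfolding power2_norm_eq_inner quot
    by (rule has_derivative_eq_rhs, rule has_derivative_divide'[OF has_derivative_power[OF num] den])
      (use nz in \<open>simp_all add: fun_eq_iff power2_eq_square algebra_simps\<close>)
qed

lemma has_derivative_weinberg_term:
  assumes "k \<in> {1..K}"
  shows "((\<lambda>z. weinberg_term K \<epsilon> n (shift_component \<psi> k n z)) has_derivative
    (\<lambda>h. nonlinear_factor K \<epsilon> \<psi> k n * (\<psi> k n * cnj h + cnj (\<psi> k n) * h))) (at 0)"
proof -
  define a b where "a = (\<Sum>j\<in>{1..K} - {k}. \<epsilon> j * (cmod (\<psi> j n))\<^sup>2)"
    and "b = (\<Sum>j\<in>{1..K} - {k}. (cmod (\<psi> j n))\<^sup>2)"
  have we: "weighted_eps K \<epsilon> (shift_component \<psi> k n z) n = a + \<epsilon> k * (cmod (\<psi> k n + z))\<^sup>2" for z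
    unfolding weighted_eps_def a_def using sum_shift_component[OF assms] .
  have pw: "photon_weight K (shift_component \<psi> k n z) n = b + (cmod (\<psi> k n + z))\<^sup>2" for z
    unfolding photon_weight_def b_def using sum_shift_component[OF assms, of "\<lambda>_. 1"] by simp
  have E: "(a + \<epsilon> k * (cmod (\<psi> k n))\<^sup>2) / (b + (cmod (\<psi> k n))\<^sup>2) = mean_eps K \<epsilon> \<psi> n"
    using we[of 0] pw[of 0] by (simp add: mean_eps_def)
  have "b \<ge> 0" unfolding b_def by (intro sum_nonneg) auto
  \<comment> \<open>If \<open>b\<close>, a sum of squares, vanishes, then all other levels of the
    sector are empty.\<close>
  moreover have "a = 0" if "b = 0"
  proof -
    have "\<forall>j\<in>{1..K} - {k}. (cmod (\<psi> j n))\<^sup>2 = 0"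
      using that unfolding b_def by (subst (asm) sum_nonneg_eq_0_iff) auto
    then show ?thesis unfolding a_def by (intro sum.neutral) auto
  qed
  ultimately have "((\<lambda>z. (a + \<epsilon> k * (cmod (\<psi> k n + z))\<^sup>2)\<^sup>2 / (b + (cmod (\<psi> k n + z))\<^sup>2))
      has_derivative (\<lambda>h. nonlinear_factor K \<epsilon> \<psi> k n * (2 * (\<psi> k n \<bullet> h)))) (at 0)"
    using has_derivative_square_quotient[of b a "\<epsilon> k" "\<psi> k n"]
    by (simp only: E nonlinear_factor_def)
  then have "((\<lambda>z. weinberg_term K \<epsilon> n (shift_component \<psi> k n z)) has_derivative
      (\<lambda>h. complex_of_real (nonlinear_factor K \<epsilon> \<psi> k n * (2 * (\<psi> k n \<bullet> h))))) (at 0)"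
    unfolding weinberg_term_eq we pw by (rule has_derivative_of_real)
  \<comment> \<open>Splitting the real inner product into an antilinear and a linear part exposes
    the Wirtinger derivative as the coefficient of \<open>cnj h\<close>.\<close>
  moreover have "complex_of_real (2 * (u \<bullet> h)) = u * cnj h + cnj u * h" for u h :: complex
    by (simp add: complex_eq_iff inner_complex_def)
  ultimately show ?thesis by (simp only: of_real_mult[of "nonlinear_factor K \<epsilon> \<psi> k n"])
qed

section \<open>The Wirtinger derivative of the whole Hamiltonian function\<close>

text \<open>Shifting one component alters only finitely many terms of each series, so the rest is a
  constant for differentiation. Summability of \<open>f\<close> passes to \<open>g\<close>, so no
  default value of a divergent sum intervenes.\<close>

lemma infsum_eq_finite_change:
  fixes f g :: "'a \<Rightarrow> 'b::banach"
  assumes "f summable_on A" "finite F" "F \<subseteq> A" "\<And>x. x \<in> A - F \<Longrightarrow> g x = f x"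
  shows "infsum g A = sum g F + infsum f (A - F)"
proof -
  have "f summable_on (A - F)"
    using assms(1) by (rule summable_on_subset_banach) auto
  then have "g summable_on (A - F)"
    using assms(4) by (subst summable_on_cong[of _ _ f]) auto
  then have "infsum g (F \<union> (A - F)) = infsum g F + infsum g (A - F)"
    using assms(2) by (intro infsum_Un_disjoint) auto
  moreover have "F \<union> (A - F) = A" using assms(3) by blast
  moreover have "infsum g (A - F) = infsum f (A - F)"
    using assms(4) by (rule infsum_cong)
  ultimately show ?thesis using assms(2) by simp
qed

text \<open>The shifted component occurs only in the rows of \<open>(k, n)\<close> and of its
  partner. The first row gives the term with \<open>cnj\<close>; the partner row is holomorphic in
  the shift and gives \<open>\<beta>\<close>, which the conjugate derivative will not see.\<close>

lemma braket_linear_shift: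
  assumes "K \<ge> 2" "k \<in> {1..K}"
    and "(\<lambda>(k, n). cnj (\<psi> k n) * linear_hamiltonian K hbar q \<omega> \<omega>s \<psi> k n)
      summable_on {1..K} \<times> UNIV"
  obtains C \<beta> where "\<And>z. braket K (shift_component \<psi> k n z)
      (linear_hamiltonian K hbar q \<omega> \<omega>s (shift_component \<psi> k n z)) =
    C + cnj (\<psi> k n + z) * (complex_of_real (hbar * \<omega>s k + hbar * \<omega> * real n) * (\<psi> k n + z)
      + coupling hbar q (k, n) * case_prod \<psi> (partner (k, n))) + \<beta> * (\<psi> k n + z)"
proof -
  let ?D = "{1..K} \<times> (UNIV :: nat set)"
  let ?g = "\<lambda>\<phi> (k, n). cnj (\<phi> k n) * linear_hamiltonian K hbar q \<omega> \<omega>s \<phi> k n"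
  define p where "p = (k, n)"
  define \<alpha> where "\<alpha> = (\<lambda>(k, n). complex_of_real (hbar * \<omega>s k + hbar * \<omega> * real n))"
  define c where "c = coupling hbar q"
  let ?s = "\<lambda>z. shift_component \<psi> k n z"
  let ?R = "infsum (?g \<psi>) (?D - {p, partner p})"
  have pD: "p \<in> ?D" and ppD: "partner p \<in> ?D"
    using assms(2) partner_in_levels[OF assms(1), of p] by (auto simp: p_def)
  have pp: "partner (partner p) = p"
    using assms(2) by (simp add: p_def)
  \<comment> \<open>Since \<open>partner\<close> is an involution on these indices,
    \<open>partner p\<close> is the only row whose off-diagonal column can be
    \<open>p\<close>.\<close>
  have inv: "partner x = p \<longleftrightarrow> x = partner p" if "x \<in> ?D" for x
    using that pp partner_partner[of "fst x" "snd x"] by auto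
  have g: "?g \<phi> x = cnj (case_prod \<phi> x) * (\<alpha> x * case_prod \<phi> x + c x * case_prod \<phi> (partner x))"
    if "x \<in> ?D" for x \<phi>
    using that by (cases x) (simp add: linear_hamiltonian_eq \<alpha>_def c_def)
  have sh: "case_prod (?s z) x = (if x = p then case_prod \<psi> p + z else case_prod \<psi> x)" for x z
    by (cases x) (auto simp: shift_component_def p_def)
  have "braket K (?s z) (linear_hamiltonian K hbar q \<omega> \<omega>s (?s z)) =
      sum (?g (?s z)) {p, partner p} + ?R" for z
    unfolding braket_def
  proof (rule infsum_eq_finite_change[OF assms(3)])
    show "{p, partner p} \<subseteq> ?D" using pD ppD by simp
    fix x assume x: "x \<in> ?D - {p, partner p}"
    then show "?g (?s z) x = ?g \<psi> x"
      using inv[of x] by (simp only: g sh DiffD1) auto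
  qed simp
  note split = this
  show thesis
  proof (cases "partner p = p")
    case True
    \<comment> \<open>Zero coupling allows the unshifted value of the partner in the formula,
      although the partner is the shifted component itself.\<close>
    then have "c p = 0" by (simp add: c_def coupling_eq_0)
    then have "braket K (?s z) (linear_hamiltonian K hbar q \<omega> \<omega>s (?s z)) =
        ?R + cnj (case_prod \<psi> p + z) * (\<alpha> p * (case_prod \<psi> p + z) + c p * case_prod \<psi> (partner p))
        + 0 * (case_prod \<psi> p + z)" for z
      unfolding split using pD True by (simp add: g sh del: split_paired_All)
    then show thesis
      by (intro that[of ?R 0]) (simp add: p_def \<alpha>_def c_def)
  next
    case False
    define y where "y = case_prod \<psi> (partner p)"
    have "braket K (?s z) (linear_hamiltonian K hbar q \<omega> \<omega>s (?s z)) =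
        (?R + cnj y * \<alpha> (partner p) * y)
        + cnj (case_prod \<psi> p + z) * (\<alpha> p * (case_prod \<psi> p + z) + c p * y)
        + cnj y * c (partner p) * (case_prod \<psi> p + z)" for z
    proof -
      have "sum (?g (?s z)) {p, partner p} = ?g (?s z) p + ?g (?s z) (partner p)"
        using False by simp
      also have "?g (?s z) p = cnj (case_prod \<psi> p + z) * (\<alpha> p * (case_prod \<psi> p + z) + c p * y)"
        using False by (simp only: g[OF pD] sh y_def if_True if_False simp_thms)
      also have "?g (?s z) (partner p) =
          cnj y * (\<alpha> (partner p) * y + c (partner p) * (case_prod \<psi> p + z))"
        using False by (simp only: g[OF ppD] sh y_def pp if_True if_False simp_thms)
      finally show ?thesis unfolding split by (simp add: algebra_simps)
    qed
    then show thesis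
      by (intro that[of "?R + cnj y * \<alpha> (partner p) * y" "cnj y * c (partner p)"])
        (simp add: p_def \<alpha>_def c_def y_def)
  qed
qed

text \<open>The combination \<open>(L 1 + \<i> * L \<i>) / 2\<close> cancels the linear part
  \<open>Y * h\<close> and returns the antilinear coefficient; uniqueness of the derivative fixes
  \<open>L\<close>.\<close>

lemma has_cnj_partial_unique:
  assumes "has_cnj_partial F D \<psi> k n"
    and "((\<lambda>z. F (shift_component \<psi> k n z)) has_derivative (\<lambda>h. X * cnj h + Y * h)) (at 0)"
  shows "D = X"
proof -
  obtain L where L: "((\<lambda>z. F (shift_component \<psi> k n z)) has_derivative L) (at 0)"
    and D: "D = (L 1 + \<i> * L \<i>) / 2"
    using assms(1) unfolding has_cnj_partial_def by blast
  have "L = (\<lambda>h. X * cnj h + Y * h)"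
    using L assms(2) by (rule has_derivative_unique)
  then show ?thesis by (simp add: D algebra_simps)
qed

text \<open>This turns the abstract equation into its explicit componentwise form. Membership in the
  domain lets the constant tails of both series be split off.\<close>

lemma has_cnj_partial_hamiltonian:
  assumes "K \<ge> 2" "k \<in> {1..K}"
    and "\<psi> \<in> hamiltonian_dom K hbar q \<omega> \<omega>s \<epsilon>"
    and "has_cnj_partial (hamiltonian K hbar q \<omega> \<omega>s \<epsilon>) D \<psi> k n"
  shows "D = complex_of_real (hbar * \<omega>s k + hbar * \<omega> * real n + nonlinear_factor K \<epsilon> \<psi> k n) * \<psi> k n
    + coupling hbar q (k, n) * case_prod \<psi> (partner (k, n))"
proof -
  define \<alpha> where "\<alpha> = complex_of_real (hbar * \<omega>s k + hbar * \<omega> * real n)"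
  define c where "c = coupling hbar q (k, n) * case_prod \<psi> (partner (k, n))"
  define r where "r = complex_of_real (nonlinear_factor K \<epsilon> \<psi> k n)"
  let ?s = "\<lambda>z. shift_component \<psi> k n z"
  have sum1: "(\<lambda>(k, n). cnj (\<psi> k n) * linear_hamiltonian K hbar q \<omega> \<omega>s \<psi> k n)
      summable_on {1..K} \<times> UNIV" and sum2: "(\<lambda>n. weinberg_term K \<epsilon> n \<psi>) summable_on UNIV"
    using assms(3) by (auto simp: hamiltonian_dom_def)
  obtain C \<beta> where lin: "\<And>z. braket K (?s z) (linear_hamiltonian K hbar q \<omega> \<omega>s (?s z)) =
      C + cnj (\<psi> k n + z) * (\<alpha> * (\<psi> k n + z) + c) + \<beta> * (\<psi> k n + z)"
    using braket_linear_shift[OF assms(1,2) sum1, of n] unfolding \<alpha>_def c_def by metis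
  \<comment> \<open>Only the term of the shifted component's own photon number changes.\<close>
  have nonlin: "(\<Sum>\<^sub>\<infinity>m. weinberg_term K \<epsilon> m (?s z)) =
      weinberg_term K \<epsilon> n (?s z) + (\<Sum>\<^sub>\<infinity>m\<in>UNIV - {n}. weinberg_term K \<epsilon> m \<psi>)" for z
  proof -
    have "(\<Sum>\<^sub>\<infinity>m. weinberg_term K \<epsilon> m (?s z)) =
        (\<Sum>m\<in>{n}. weinberg_term K \<epsilon> m (?s z)) + (\<Sum>\<^sub>\<infinity>m\<in>UNIV - {n}. weinberg_term K \<epsilon> m \<psi>)"
      by (rule infsum_eq_finite_change[OF sum2])
        (auto simp: weinberg_term_eq weighted_eps_def photon_weight_def shift_component_def)
    then show ?thesis by simp
  qed
  have "((\<lambda>z. C + cnj (\<psi> k n + z) * (\<alpha> * (\<psi> k n + z) + c) + \<beta> * (\<psi> k n + z)) has_derivative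
      (\<lambda>h. (\<alpha> * \<psi> k n + c) * cnj h + (\<alpha> * cnj (\<psi> k n) + \<beta>) * h)) (at 0)"
    by (auto intro!: derivative_eq_intros ext simp: algebra_simps)
  from has_derivative_add[OF this has_derivative_add[OF
      has_derivative_weinberg_term[OF assms(2), of \<epsilon> n \<psi>] has_derivative_const]]
  have "((\<lambda>z. hamiltonian K hbar q \<omega> \<omega>s \<epsilon> (?s z)) has_derivative
      (\<lambda>h. ((\<alpha> + r) * \<psi> k n + c) * cnj h + ((\<alpha> + r) * cnj (\<psi> k n) + \<beta>) * h)) (at 0)"
    unfolding hamiltonian_def lin nonlin r_def[symmetric]
    by (rule has_derivative_eq_rhs) (simp add: fun_eq_iff algebra_simps)
  from has_cnj_partial_unique[OF assms(4) this] show ?thesis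
    by (simp add: \<alpha>_def r_def c_def)
qed

section \<open>The componentwise equation and its conserved weights\<close>

lemma schroedinger_solution_component:
  assumes "K \<ge> 2" "schroedinger_solution K hbar q \<omega> \<omega>s \<epsilon> T \<psi>" "t \<in> T" "k \<in> {1..K}"
  obtains d where "((\<lambda>s. \<psi> s k n) has_vector_derivative d) (at t within T)"
    and "\<i> * complex_of_real hbar * d =
      complex_of_real (hbar * \<omega>s k + hbar * \<omega> * real n + nonlinear_factor K \<epsilon> (\<psi> t) k n) * \<psi> t k n
      + coupling hbar q (k, n) * case_prod (\<psi> t) (partner (k, n))"
proof -
  have dom: "\<psi> t \<in> hamiltonian_dom K hbar q \<omega> \<omega>s \<epsilon>"
    using assms(2,3) unfolding schroedinger_solution_def by blast
  obtain d where "((\<lambda>s. \<psi> s k n) has_vector_derivative d) (at t within T)"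
    and "has_cnj_partial (hamiltonian K hbar q \<omega> \<omega>s \<epsilon>) (\<i> * complex_of_real hbar * d) (\<psi> t) k n"
    using assms(2-4) unfolding schroedinger_solution_def by blast
  then show thesis
    using that has_cnj_partial_hamiltonian[OF assms(1,4) dom] by blast
qed

text \<open>Up to the factor \<open>h\<close>, \<open>u \<bullet> du\<close> is the imaginary part
  of \<open>cnj u\<close> times the right-hand side for \<open>u\<close>. The real diagonal terms
  drop out, and the two coupling terms are conjugate to each other, so their imaginary parts
  cancel.\<close>

lemma hermitian_pair_inner_0:
  fixes u v du dv :: complex and a b :: real
  assumes "h \<noteq> 0"
    and "\<i> * complex_of_real h * du = complex_of_real a * u + c * v"
    and "\<i> * complex_of_real h * dv = complex_of_real b * v + cnj c * u"
  shows "u \<bullet> du + v \<bullet> dv = 0"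
proof -
  have h: "h * Im du = - Re (complex_of_real a * u + c * v)"
    "h * Re du = Im (complex_of_real a * u + c * v)"
    "h * Im dv = - Re (complex_of_real b * v + cnj c * u)"
    "h * Re dv = Im (complex_of_real b * v + cnj c * u)"
    using assms(2,3) by (auto simp: complex_eq_iff)
  have "h * (u \<bullet> du + v \<bullet> dv) =
      Re u * (h * Re du) + Im u * (h * Im du) + Re v * (h * Re dv) + Im v * (h * Im dv)"
    by (simp add: inner_complex_def algebra_simps)
  also have "\<dots> = 0" unfolding h by (simp add: algebra_simps)
  finally show ?thesis using assms(1) by simp
qed

lemma pair_weight_constant:
  assumes "K \<ge> 2" "hbar > 0" "is_interval T" "0 \<in> T" "t \<in> T" "p \<in> {1..K} \<times> UNIV"
    and sol: "schroedinger_solution K hbar q \<omega> \<omega>s \<epsilon> T \<psi>"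
  defines "W \<equiv> \<lambda>s. (cmod (case_prod (\<psi> s) p))\<^sup>2 + (cmod (case_prod (\<psi> s) (partner p)))\<^sup>2"
  shows "W t = W 0"
proof -
  \<comment> \<open>All diagonal contributions, including the state-dependent nonlinear one, are
    merged into \<open>a\<close>; only its being real matters.\<close>
  have eq: "\<exists>d a. ((\<lambda>s. case_prod (\<psi> s) x) has_vector_derivative d) (at s within T) \<and>
      \<i> * complex_of_real hbar * d = complex_of_real a * case_prod (\<psi> s) x
        + coupling hbar q x * case_prod (\<psi> s) (partner x)"
    if "s \<in> T" "x \<in> {1..K} \<times> UNIV" for s x
  proof -
    obtain k n where x: "x = (k, n)" by fastforce
    then show ?thesis
      using that(2) schroedinger_solution_component[OF assms(1) sol that(1), of k n]
      by (simp del: of_real_add of_real_mult) blast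
  qed
  have pp: "partner (partner p) = p"
    using assms(6) by auto
  have "(W has_derivative (\<lambda>h. 0)) (at s within T)" if s: "s \<in> T" for s
  proof -
    let ?u = "case_prod (\<psi> s) p" and ?v = "case_prod (\<psi> s) (partner p)"
    obtain du a where du: "((\<lambda>s. case_prod (\<psi> s) p) has_vector_derivative du) (at s within T)"
      and ua: "\<i> * complex_of_real hbar * du = complex_of_real a * ?u + coupling hbar q p * ?v"
      using eq[OF s assms(6)] by blast
    obtain dv b where dv: "((\<lambda>s. case_prod (\<psi> s) (partner p)) has_vector_derivative dv)
        (at s within T)"
      and vb: "\<i> * complex_of_real hbar * dv =
        complex_of_real b * ?v + coupling hbar q (partner p) * ?u"
      using eq[OF s partner_in_levels[OF assms(1,6)]] unfolding pp by blast
    note du' = du[unfolded has_vector_derivative_def]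
      and dv' = dv[unfolded has_vector_derivative_def]
    \<comment> \<open>For a component that is its own partner both sides are 0, and \<open>W\<close>
      is just twice its squared modulus.\<close>
    have "coupling hbar q (partner p) = cnj (coupling hbar q p)"
      by (cases "partner p = p") (simp_all add: coupling_partner coupling_eq_0)
    then have "?u \<bullet> du + ?v \<bullet> dv = 0"
      using hermitian_pair_inner_0[OF _ ua] vb assms(2) by simp
    moreover have "(W has_derivative (\<lambda>h. 2 * h * (?u \<bullet> du + ?v \<bullet> dv))) (at s within T)"
      unfolding W_def power2_norm_eq_inner
      by (rule has_derivative_eq_rhs,
          rule has_derivative_add[OF has_derivative_inner[OF du' du'] has_derivative_inner[OF dv' dv']])
        (simp add: fun_eq_iff inner_commute algebra_simps)
    ultimately show ?thesis by simp
  qed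
  then show ?thesis
    using is_interval_convex[OF assms(3)] has_derivative_zero_unique assms(4,5) by metis
qed

section \<open>Reduction to the initially excited pair\<close>

text \<open>The factor \<open>\<psi> k n\<close> is kept on both sides because in an empty sector
  the mean is \<open>0 / 0 = 0\<close>, and the nonlinear factor alone need not equal
  \<open>(\<epsilon> k)\<^sup>2\<close>.\<close>

lemma nonlinear_factor_single_level:
  assumes "k \<in> {1..K}" "\<And>j. j \<in> {1..K} \<Longrightarrow> j \<noteq> k \<Longrightarrow> \<psi> j n = 0"
  shows "complex_of_real (nonlinear_factor K \<epsilon> \<psi> k n) * \<psi> k n = complex_of_real ((\<epsilon> k)\<^sup>2) * \<psi> k n"
proof (cases "\<psi> k n = 0")
  case False
  have "weighted_eps K \<epsilon> \<psi> n = \<epsilon> k * (cmod (\<psi> k n))\<^sup>2"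
    "photon_weight K \<psi> n = (cmod (\<psi> k n))\<^sup>2"
    unfolding weighted_eps_def photon_weight_def sum.remove[OF finite_atLeastAtMost assms(1)]
    using assms(2) by (auto intro!: sum.neutral)
  then have "mean_eps K \<epsilon> \<psi> n = \<epsilon> k"
    using False by (simp add: mean_eps_def)
  then show ?thesis by (simp add: nonlinear_factor_def power2_eq_square)
qed simp

theorem mainTheorem3:
  fixes K :: nat and hbar q \<omega> :: real and \<omega>s \<epsilon> :: "nat \<Rightarrow> real"
    and T :: "real set" and \<psi> :: "real \<Rightarrow> state"
  assumes "K \<ge> 2" and "hbar > 0"
    and "is_interval T" and "0 \<in> T"
    and "schroedinger_solution K hbar q \<omega> \<omega>s \<epsilon> T \<psi>"
    and "\<And>k n. k \<in> {1..K} \<Longrightarrow> \<psi> 0 k n \<noteq> 0 \<longleftrightarrow> (k, n) = (1, 1)"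
  shows "(\<forall>t\<in>T. \<forall>k\<in>{1..K}. \<forall>n. \<psi> t k n \<noteq> 0 \<longrightarrow> (k, n) \<in> {(1, 1), (2, 0)})
    \<and> (\<forall>t\<in>T. \<exists>d. ((\<lambda>s. \<psi> s 1 1) has_vector_derivative d) (at t within T) \<and>
         \<i> * complex_of_real hbar * d =
           complex_of_real (hbar * \<omega>s 1 + hbar * \<omega> + (\<epsilon> 1)\<^sup>2) * \<psi> t 1 1
           - \<i> / 2 * complex_of_real (hbar * q) * \<psi> t 2 0)
    \<and> (\<forall>t\<in>T. \<exists>d. ((\<lambda>s. \<psi> s 2 0) has_vector_derivative d) (at t within T) \<and>
         \<i> * complex_of_real hbar * d =
           complex_of_real (hbar * \<omega>s 2 + (\<epsilon> 2)\<^sup>2) * \<psi> t 2 0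
           + \<i> / 2 * complex_of_real (hbar * q) * \<psi> t 1 1)"
proof -
  have levels: "(1::nat) \<in> {1..K}" "2 \<in> {1..K}" using assms(1) by auto
  have supp: "\<psi> t k n = 0" if t: "t \<in> T" and k: "k \<in> {1..K}" and off: "(k, n) \<notin> {(1, 1), (2, 0)}"
    for t k n
  proof -
    obtain k' n' where p: "partner (k, n) = (k', n')" by fastforce
    \<comment> \<open>The set of \<open>(1, 1)\<close> and \<open>(2, 0)\<close> is a full pair, so
      the partner of an index outside it also lies outside, and the pair starts with weight
      0.\<close>
    have "k' \<in> {1..K}" "(k', n') \<noteq> (1, 1)"
      using p partner_in_levels[OF assms(1), of "(k, n)"] k off
      by (auto simp: partner_def split: if_splits)
    then have "\<psi> 0 k n = 0" "\<psi> 0 k' n' = 0"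
      using assms(6) k off by blast+
    then have "(cmod (\<psi> t k n))\<^sup>2 + (cmod (\<psi> t k' n'))\<^sup>2 = 0"
      using pair_weight_constant[OF assms(1-4) t _ assms(5), of "(k, n)"] k p by simp
    then show ?thesis by (simp add: add_nonneg_eq_0_iff)
  qed
  have single: "\<exists>d. ((\<lambda>s. \<psi> s k n) has_vector_derivative d) (at t within T) \<and>
      \<i> * complex_of_real hbar * d =
        complex_of_real (hbar * \<omega>s k + hbar * \<omega> * real n + (\<epsilon> k)\<^sup>2) * \<psi> t k n
        + coupling hbar q (k, n) * case_prod (\<psi> t) (partner (k, n))"
    if t: "t \<in> T" and kn: "(k, n) \<in> {(1, 1), (2, 0)}" for t k n
  proof -
    have k: "k \<in> {1..K}" using kn levels by auto
    \<comment> \<open>The two surviving components have different photon numbers, so each is alone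
      in its sector.\<close>
    have "\<psi> t j n = 0" if "j \<in> {1..K}" "j \<noteq> k" for j
      using supp[OF t that(1)] that(2) kn by auto
    then have "complex_of_real (nonlinear_factor K \<epsilon> (\<psi> t) k n) * \<psi> t k n =
        complex_of_real ((\<epsilon> k)\<^sup>2) * \<psi> t k n"
      using nonlinear_factor_single_level[OF k] by blast
    moreover obtain d where "((\<lambda>s. \<psi> s k n) has_vector_derivative d) (at t within T)"
      "\<i> * complex_of_real hbar * d =
        complex_of_real (hbar * \<omega>s k + hbar * \<omega> * real n + nonlinear_factor K \<epsilon> (\<psi> t) k n) * \<psi> t k n
        + coupling hbar q (k, n) * case_prod (\<psi> t) (partner (k, n))"
      using schroedinger_solution_component[OF assms(1,5) t k] .
    ultimately show ?thesis
      by (intro exI[of _ d]) (simp add: distrib_right)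
  qed
  show ?thesis
  proof (intro conjI ballI)
    show "\<forall>n. \<psi> t k n \<noteq> 0 \<longrightarrow> (k, n) \<in> {(1, 1), (2, 0)}" if "t \<in> T" "k \<in> {1..K}" for t k
      using supp[OF that] by blast
  next
    fix t assume t: "t \<in> T"
    show "\<exists>d. ((\<lambda>s. \<psi> s 1 1) has_vector_derivative d) (at t within T) \<and>
        \<i> * complex_of_real hbar * d =
          complex_of_real (hbar * \<omega>s 1 + hbar * \<omega> + (\<epsilon> 1)\<^sup>2) * \<psi> t 1 1
          - \<i> / 2 * complex_of_real (hbar * q) * \<psi> t 2 0"
      \<comment> \<open>In both remaining equations the root in the coupling is
        \<open>sqrt 1\<close>.\<close>
      using single[OF t, of 1 1] by (simp add: coupling_def partner_def)
    show "\<exists>d. ((\<lambda>s. \<psi> s 2 0) has_vector_derivative d) (at t within T) \<and>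
        \<i> * complex_of_real hbar * d =
          complex_of_real (hbar * \<omega>s 2 + (\<epsilon> 2)\<^sup>2) * \<psi> t 2 0
          + \<i> / 2 * complex_of_real (hbar * q) * \<psi> t 1 1"
      using single[OF t, of 2 0] by (simp add: coupling_def partner_def)
  qed
qed

end
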